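(* Let $k\geq 3$ be an integer and let $A$ be a finite set of $k$ non-negative integers with $0\in A$ such that $|k\hat{}_{\underline{+}}A|=\binom{k}{2}+1$. Then: (i) if $k=3$, $A=\{0,a_1,a_2\}$ for some integers $0<a_1<a_2$; (ii) if $k=4$, $A=\{0,a_1,a_2,a_1+a_2\}$ for some integers $0<a_1<a_2$; (iii) if $k\geq 5$, $A=d*[0,k-1]$ for some positive integer $d$.
   Context: For a finite set $A=\{a_0,a_1,\ldots,a_{k-1}\}$ of $k$ distinct integers and an integer $1\leq h\leq k$, the $h$-fold restricted signed sumset of $A$ is $$h\hat{}_{\underline{+}}A:=\Big\{\sum_{i=0}^{k-1}\lambda_i a_i : (\lambda_0,\ldots,\lambda_{k-1})\in\{-1,0,1\}^k,\ \sum_{i=0}^{k-1}|\lambda_i|=h\Big\}.$$ Here it is used with $h=k$. $|S|$ denotes the cardinality of a finite set $S$. For integers $a\leq b$, $[a,b]=\{n\in\mathbb{Z}: a\leq n\leq b\}$. For an integer $d$ and a set $S$ of integers, $d*S=\{d\cdot s : s\in S\}$ is the $d$-dilation of $S$. *)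

theory Defs
  imports Complex_Main
begin

(* The h-fold restricted signed sumset of a finite set A of integers. The coefficient tuple
   is a function c on A, with c a the coefficient of a; its values outside A are irrelevant.
   Meant for finite A and 1 <= h <= card A. *)
definition restricted_signed_sumset :: "nat \<Rightarrow> int set \<Rightarrow> int set" where
  "restricted_signed_sumset h A =
     {\<Sum>a\<in>A. c a * a | c :: int \<Rightarrow> int.
        (\<forall>a\<in>A. c a \<in> {-1, 0, 1}) \<and> (\<Sum>a\<in>A. \<bar>c a\<bar>) = int h}"

definition dilation :: "int \<Rightarrow> int set \<Rightarrow> int set" where
  "dilation d S = (\<lambda>s. d * s) ` S"

end

theory Submission
  imports Defs
begin

text \<open>
  Since \<open>h = k\<close> forces every coefficient to be \<open>1\<close> or \<open>-1\<close>, a signed sum is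
  \<open>2 * s - \<Sum>A\<close>, where \<open>s\<close> is the sum of the elements with coefficient \<open>1\<close>. The
  question is therefore which sets \<open>B = A - {0}\<close> of \<open>n = k - 1\<close> positive integers have
  exactly \<open>1 + (1 + 2 + \<dots> + n)\<close> subset sums.

  Build \<open>B\<close> by adding elements in increasing order. When a new largest element \<open>b\<close> is added
  to a set \<open>B\<close>, the old subset sums, which are at most \<open>\<Sum>B\<close>, survive, and the sums
  \<open>\<Sum>B + b - x\<close> with \<open>x = 0\<close> or \<open>x \<in> B\<close> are new, because they exceed \<open>\<Sum>B\<close>. So each
  step adds at least \<open>card B + 1\<close> sums, and the count above is the least possible. A set
  that attains it must attain it at every step, with no subset sums besides the ones just listed
  (\<open>subset_sums_insert_max_tight\<close>). The sums of the new set up to \<open>\<Sum>B\<close> are then sums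
  of \<open>B\<close>; by the symmetry \<open>s \<mapsto> \<Sum>B + b - s\<close>, those below \<open>b\<close> are \<open>0\<close> and
  the elements of \<open>B\<close>. Hence, once \<open>B\<close> has two elements, \<open>b\<close> is determined: it is the
  least subset sum of \<open>B\<close> that is neither \<open>0\<close> nor in \<open>B\<close>
  (\<open>minimal_insert_max\<close>).

  From \<open>{a, b}\<close> this gives \<open>{a, b, a + b}\<close>, whose next element is \<open>2 * a + b\<close>. At this
  point \<open>3 * a + b\<close> is a sum below \<open>2 * a + 2 * b\<close>, so it already was a sum of the three
  elements; this is possible only for \<open>b = 2 * a\<close>. From then on the set is
  \<open>{d, 2 * d, \<dots>, m * d}\<close>, and its least further subset sum is \<open>(m + 1) * d\<close>.
\<close>

definition subset_sums :: "int set \<Rightarrow> int set" where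
  "subset_sums B = \<Sum> ` Pow B"

text \<open>
  \<open>Suc n choose 2\<close> is \<open>1 + 2 + \<dots> + n\<close>. The name anticipates
  \<open>card_subset_sums_ge\<close>: for positive elements this is the least possible number.
\<close>

definition minimal_subset_sums :: "int set \<Rightarrow> bool" where
  "minimal_subset_sums B \<longleftrightarrow> card (subset_sums B) = (Suc (card B) choose 2) + 1"

lemma finite_subset_sums: "finite B \<Longrightarrow> finite (subset_sums B)"
  by (simp add: subset_sums_def)

lemma sum_in_subset_sums: "X \<subseteq> B \<Longrightarrow> \<Sum>X \<in> subset_sums B"
  by (auto simp: subset_sums_def)

lemma subset_sums_mono: "B \<subseteq> C \<Longrightarrow> subset_sums B \<subseteq> subset_sums C"
  by (auto simp: subset_sums_def)

lemma subset_sums_le_sum: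
  assumes "finite B" "\<forall>x\<in>B. 0 < x" "s \<in> subset_sums B"
  shows "s \<le> \<Sum>B"
  using assms by (auto simp: subset_sums_def intro!: sum_mono2)

text \<open>Complementation of the subset.\<close>

lemma subset_sums_reflect:
  assumes "finite B" "s \<in> subset_sums B"
  shows "\<Sum>B - s \<in> subset_sums B"
proof -
  obtain X where X: "X \<subseteq> B" "s = \<Sum>X" using assms(2) by (auto simp: subset_sums_def)
  have "\<Sum>(B - X) = \<Sum>B - s" using X assms(1) by (simp add: sum_diff)
  then show ?thesis using sum_in_subset_sums[of "B - X" B] by auto
qed

lemma zero_in_subset_sums: "0 \<in> subset_sums B"
  using sum_in_subset_sums[of "{}" B] by simp

lemma member_in_subset_sums: "x \<in> B \<Longrightarrow> x \<in> subset_sums B"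
  using sum_in_subset_sums[of "{x}" B] by simp

lemma add_in_subset_sums: "x \<in> B \<Longrightarrow> y \<in> B \<Longrightarrow> x \<noteq> y \<Longrightarrow> x + y \<in> subset_sums B"
  using sum_in_subset_sums[of "{x, y}" B] by simp

lemma subset_sums_Diff_zero:
  assumes "finite A"
  shows "subset_sums (A - {0}) = subset_sums A"
proof
  show "subset_sums A \<subseteq> subset_sums (A - {0})"
  proof
    fix s assume "s \<in> subset_sums A"
    then obtain X where X: "X \<subseteq> A" "s = \<Sum>X" by (auto simp: subset_sums_def)
    then have "\<Sum>(X - {0}) = s" using finite_subset[OF _ assms] by (auto simp: sum_diff1)
    then show "s \<in> subset_sums (A - {0})"
      using X sum_in_subset_sums[of "X - {0}" "A - {0}"] by auto
  qed
qed (simp add: subset_sums_mono)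


section \<open>Signed sums and subset sums\<close>

text \<open>
  A coefficient function whose absolute values are at most \<open>1\<close> and add up to the number of
  elements has no zero; its positive set is the subset that is summed.
\<close>

lemma full_restricted_signed_sumset:
  assumes "finite A"
  shows "restricted_signed_sumset (card A) A = (\<lambda>s. 2 * s - \<Sum>A) ` subset_sums A"
proof
  show "restricted_signed_sumset (card A) A \<subseteq> (\<lambda>s. 2 * s - \<Sum>A) ` subset_sums A"
  proof
    fix t assume "t \<in> restricted_signed_sumset (card A) A"
    then obtain c where c: "\<forall>a\<in>A. c a \<in> {-1, 0, 1}" "(\<Sum>a\<in>A. \<bar>c a\<bar>) = int (card A)"
      and t: "t = (\<Sum>a\<in>A. c a * a)"
      by (auto simp: restricted_signed_sumset_def)
    have "(\<Sum>a\<in>A. 1 - \<bar>c a\<bar>) = 0" using c(2) by (simp add: sum_subtractf)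
    then have "\<forall>a\<in>A. 1 - \<bar>c a\<bar> = 0"
      using c(1) assms by (subst (asm) sum_nonneg_eq_0_iff) auto
    then have sign: "\<forall>a\<in>A. c a = (if c a = 1 then 2 else 0) - 1" using c(1) by auto
    let ?X = "{a \<in> A. c a = 1}"
    have "t = (\<Sum>a\<in>A. 2 * (if c a = 1 then a else 0) - a)"
      unfolding t using sign by (intro sum.cong) (auto split: if_splits)
    also have "\<dots> = 2 * \<Sum>?X - \<Sum>A"
      using assms by (simp add: sum_subtractf sum_distrib_left[symmetric] sum.inter_filter)
    finally show "t \<in> (\<lambda>s. 2 * s - \<Sum>A) ` subset_sums A"
      using sum_in_subset_sums[of ?X A] by blast
  qed
  show "(\<lambda>s. 2 * s - \<Sum>A) ` subset_sums A \<subseteq> restricted_signed_sumset (card A) A"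
  proof
    fix t assume "t \<in> (\<lambda>s. 2 * s - \<Sum>A) ` subset_sums A"
    then obtain X where X: "X \<subseteq> A" "t = 2 * \<Sum>X - \<Sum>A" by (auto simp: subset_sums_def)
    define c where "c = (\<lambda>a. if a \<in> X then 1 else - 1 :: int)"
    have "(\<Sum>a\<in>A. c a * a) = (\<Sum>a\<in>A. 2 * (if a \<in> X then a else 0) - a)"
      by (intro sum.cong) (auto simp: c_def)
    also have "\<dots> = t"
      using assms X
      by (simp add: sum_subtractf sum_distrib_left[symmetric] sum.inter_restrict[symmetric]
          Int_absorb1)
    finally have "t = (\<Sum>a\<in>A. c a * a)" by simp
    moreover have "(\<Sum>a\<in>A. \<bar>c a\<bar>) = int (card A)" by (simp add: c_def if_distrib cong: if_cong)
    moreover have "\<forall>a\<in>A. c a \<in> {-1, 0, 1}" by (simp add: c_def)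
    ultimately show "t \<in> restricted_signed_sumset (card A) A"
      unfolding restricted_signed_sumset_def by blast
  qed
qed

lemma card_full_restricted_signed_sumset:
  assumes "finite A"
  shows "card (restricted_signed_sumset (card A) A) = card (subset_sums (A - {0}))"
  using assms
  by (simp add: full_restricted_signed_sumset subset_sums_Diff_zero card_image inj_on_def)


section \<open>Adding a new largest element\<close>

context
  fixes B :: "int set" and b :: int
  assumes fin: "finite B" and pos: "\<forall>x\<in>B. 0 < x" and b_pos: "0 < b"
    and below: "\<forall>x\<in>B. x < b"
begin

lemma b_notin: "b \<notin> B"
  using below by blast

lemma subset_sums_insert_max_supset:
  "subset_sums B \<union> (\<lambda>x. \<Sum>B + b - x) ` insert 0 B \<subseteq> subset_sums (insert b B)"
proof -
  have "\<Sum>B + b - x \<in> subset_sums (insert b B)" if "x \<in> insert 0 B" for x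
    using subset_sums_reflect[of "insert b B" x] that fin b_notin
      zero_in_subset_sums member_in_subset_sums[of x "insert b B"]
    by (auto simp: algebra_simps)
  then show ?thesis using subset_sums_mono[of B "insert b B"] by blast
qed

lemma card_subset_sums_insert_max_part:
  "card (subset_sums B \<union> (\<lambda>x. \<Sum>B + b - x) ` insert 0 B) = card (subset_sums B) + card B + 1"
proof -
  have "\<Sum>B < \<Sum>B + b - x" if "x \<in> insert 0 B" for x
    using that below b_pos by auto
  then have "subset_sums B \<inter> (\<lambda>x. \<Sum>B + b - x) ` insert 0 B = {}"
    using subset_sums_le_sum[OF fin pos] by fastforce
  moreover have "card ((\<lambda>x. \<Sum>B + b - x) ` insert 0 B) = card B + 1"
    using pos fin by (subst card_image) (auto simp: inj_on_def)
  ultimately show ?thesis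
    using fin finite_subset_sums[OF fin] by (subst card_Un_disjoint) auto
qed

lemma card_subset_sums_insert_max:
  "card (subset_sums B) + card B + 1 \<le> card (subset_sums (insert b B))"
  using card_mono[OF _ subset_sums_insert_max_supset] finite_subset_sums[of "insert b B"] fin
  unfolding card_subset_sums_insert_max_part by simp

lemma subset_sums_insert_max_tight:
  assumes "card (subset_sums (insert b B)) = card (subset_sums B) + card B + 1"
  shows "subset_sums (insert b B) = subset_sums B \<union> (\<lambda>x. \<Sum>B + b - x) ` insert 0 B"
  using card_subset_eq[OF _ subset_sums_insert_max_supset] finite_subset_sums[of "insert b B"] fin
    assms
  unfolding card_subset_sums_insert_max_part by (metis finite.insertI)

end

lemma card_subset_sums_ge:
  assumes "finite B" "\<forall>x\<in>B. 0 < x"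
  shows "(Suc (card B) choose 2) + 1 \<le> card (subset_sums B)"
  using assms
proof (induction rule: finite_linorder_max_induct)
  case empty
  then show ?case by (simp add: subset_sums_def)
next
  case (insert b B)
  have "b \<notin> B" using insert.hyps by blast
  moreover have "card (subset_sums B) + card B + 1 \<le> card (subset_sums (insert b B))"
    using insert.hyps insert.prems by (intro card_subset_sums_insert_max) auto
  ultimately show ?case using insert by (simp add: numeral_2_eq_2)
qed

text \<open>
  The last two conclusions constrain \<open>b\<close>: small sums that involve \<open>b\<close> must already be sums
  of \<open>B\<close>, and every sum of \<open>B\<close> other than \<open>0\<close> and its elements bounds \<open>b\<close> from
  above. The second of them is the reflection of the description of the sums beyond \<open>\<Sum>B\<close>.
\<close>

lemma minimal_insert_max_conditions:
  assumes "finite B" "\<forall>x\<in>insert b B. 0 < x" "\<forall>x\<in>B. x < b"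
    and min: "minimal_subset_sums (insert b B)"
  shows "minimal_subset_sums B"
    and "card (insert b B) = card B + 1"
    and "\<And>s. s \<in> subset_sums (insert b B) \<Longrightarrow> s \<le> \<Sum>B \<Longrightarrow> s \<in> subset_sums B"
    and "\<And>s. s \<in> subset_sums (insert b B) \<Longrightarrow> s < b \<Longrightarrow> s \<in> insert 0 B"
proof -
  have b: "0 < b" "b \<notin> B" and pos: "\<forall>x\<in>B. 0 < x" using assms by auto
  show card: "card (insert b B) = card B + 1" using b assms(1) by simp
  have eq: "card (subset_sums (insert b B)) = (Suc (card B) choose 2) + 1 + card B + 1"
    using min card by (simp add: minimal_subset_sums_def numeral_2_eq_2)
  then show "minimal_subset_sums B"
    using card_subset_sums_insert_max[OF assms(1) pos b(1) assms(3)]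
      card_subset_sums_ge[OF assms(1) pos]
    by (simp add: minimal_subset_sums_def)
  then have split: "subset_sums (insert b B) = subset_sums B \<union> (\<lambda>x. \<Sum>B + b - x) ` insert 0 B"
    using eq
    by (intro subset_sums_insert_max_tight[OF assms(1) pos b(1) assms(3)])
      (simp add: minimal_subset_sums_def)
  show "s \<in> subset_sums B" if "s \<in> subset_sums (insert b B)" "s \<le> \<Sum>B" for s
    using that assms(3) b unfolding split by force
  show "s \<in> insert 0 B" if s: "s \<in> subset_sums (insert b B)" "s < b" for s
  proof -
    have "\<Sum>B + b - s \<in> subset_sums (insert b B)"
      using subset_sums_reflect[of "insert b B" s] s(1) assms(1) b by (simp add: add.commute)
    moreover have "\<Sum>B + b - s \<notin> subset_sums B"
      using subset_sums_le_sum[OF assms(1) pos] s(2) by fastforce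
    ultimately have "\<Sum>B + b - s \<in> (\<lambda>x. \<Sum>B + b - x) ` insert 0 B"
      unfolding split by blast
    then show ?thesis by auto
  qed
qed

text \<open>
  If \<open>b\<close> were larger than \<open>\<Sum>B\<close>, then \<open>\<Sum>B\<close> itself would be a subset sum below \<open>b\<close>
  and hence an element of \<open>B\<close>, which a sum of at least two positive elements cannot be.
\<close>

lemma minimal_insert_max:
  assumes "finite B" "\<forall>x\<in>insert b B. 0 < x" "\<forall>x\<in>B. x < b"
    and min: "minimal_subset_sums (insert b B)" and two: "2 \<le> card B"
  shows "b \<in> subset_sums B" and "b \<le> \<Sum>B"
    and "\<And>s. s \<in> subset_sums B \<Longrightarrow> s \<notin> insert 0 B \<Longrightarrow> b \<le> s"
proof -
  note cond = minimal_insert_max_conditions[OF assms(1-4)]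
  show least: "b \<le> s" if "s \<in> subset_sums B" "s \<notin> insert 0 B" for s
    using cond(4)[of s] subset_sums_mono[of B "insert b B"] that by fastforce
  have "\<Sum>B \<noteq> x" if "x \<in> insert 0 B" for x
  proof -
    have "B - {x} \<noteq> {}"
    proof
      assume "B - {x} = {}"
      then have "card B \<le> card {x}" by (intro card_mono) auto
      then show False using two by simp
    qed
    then have "0 < \<Sum>(B - {x})" using assms(1,2) by (intro sum_pos) auto
    also have "\<dots> = \<Sum>B - x" using that assms(1) by (auto simp: sum_diff1)
    finally show ?thesis by simp
  qed
  then show "b \<le> \<Sum>B" using least[of "\<Sum>B"] sum_in_subset_sums[of B B] by blast
  then show "b \<in> subset_sums B" using cond(3)[of b] member_in_subset_sums[of b "insert b B"] by simp
qed


section \<open>Sets of positive integers with the fewest subset sums\<close>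

lemma minimal_three:
  assumes "finite C" "\<forall>x\<in>C. 0 < x" "minimal_subset_sums C" "card C = 3"
  shows "\<exists>a b. 0 < a \<and> a < b \<and> C = {a, b, a + b}"
proof -
  define c where "c = Max C"
  define B where "B = C - {c}"
  have "C \<noteq> {}" using assms(4) by auto
  then have C: "C = insert c B" and c: "c \<in> C" using Max_in[OF assms(1)] by (auto simp: B_def c_def)
  have below: "\<forall>x\<in>B. x < c" using Max_ge[OF assms(1)] by (fastforce simp: B_def c_def)
  have "card B = 2" using c assms(1,4) by (simp add: B_def)
  then obtain a b where ab: "B = {a, b}" "a < b"
    by (metis card_2_iff insert_commute linorder_neqE_linordered_idom)
  have fin: "finite B" using assms(1) by (simp add: B_def)
  note least_sum = minimal_insert_max[OF fin assms(2)[unfolded C] below assms(3)[unfolded C]]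
  have pos: "0 < a" using assms(2) C ab by simp
  have "c \<le> a + b"
    using least_sum(3)[of "a + b"] add_in_subset_sums[of a B b] ab pos \<open>card B = 2\<close> by simp
  moreover have "c \<in> subset_sums B" using least_sum(1) \<open>card B = 2\<close> by simp
  then have "c \<in> {0, a, b, a + b}"
    using ab by (auto simp: subset_sums_def Pow_insert)
  ultimately have "c = a + b" using below ab pos by auto
  then show ?thesis using C ab pos by (intro exI[of _ a] exI[of _ b]) auto
qed

lemma subset_sums_three:
  assumes "0 < a" "a < b" "s \<in> subset_sums {a, b, a + b}"
  shows "s \<in> {0, a, b, a + b, 2 * a + b, a + 2 * b, 2 * a + 2 * (b :: int)}"
  using assms by (auto simp: subset_sums_def Pow_insert)

text \<open>
  Three elements \<open>p\<close>, \<open>q\<close>, \<open>p + q\<close> still leave the ratio of \<open>q\<close> to \<open>p\<close>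
  free. The fourth, \<open>b = 2 * p + q\<close>, fixes it: \<open>p + b\<close> lies strictly between the two
  largest sums \<open>p + 2 * q\<close> and \<open>2 * p + 2 * q\<close> of the three elements if
  \<open>q < 2 * p\<close>, and strictly between \<open>2 * p + q\<close> and \<open>p + 2 * q\<close> if
  \<open>q > 2 * p\<close>, although it has to be one of their sums.
\<close>

lemma minimal_insert_max_three:
  assumes "finite B" "\<forall>x\<in>insert b B. 0 < x" "\<forall>x\<in>B. x < b"
    and min: "minimal_subset_sums (insert b B)" and "card B = 3"
  shows "\<exists>d>0. insert b B = dilation d {1..4}"
proof -
  note cond = minimal_insert_max_conditions[OF assms(1-4)]
  note least_sum = minimal_insert_max[OF assms(1-4)]
  obtain p q where pq: "0 < p" "p < q" "B = {p, q, p + q}"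
    using minimal_three[OF assms(1) _ cond(1)] assms(2,5) by auto
  have sum: "\<Sum>B = 2 * p + 2 * q" using pq by simp
  have "2 * p + q \<in> subset_sums B"
    using add_in_subset_sums[of p B "p + q"] pq by (simp add: algebra_simps)
  then have "b \<le> 2 * p + q" using least_sum(3)[of "2 * p + q"] pq assms(5) by simp
  moreover have "b \<in> subset_sums B" using least_sum(1) assms(5) by simp
  ultimately have b: "b = 2 * p + q"
    using subset_sums_three[of p q b] pq assms(3) by auto
  have "3 * p + q \<in> subset_sums (insert b B)"
    using add_in_subset_sums[of p "insert b B" b] pq b by (simp add: algebra_simps)
  then have "3 * p + q \<in> subset_sums B" using cond(3) sum pq by simp
  then have "q = 2 * p" using subset_sums_three[of p q "3 * p + q"] pq by auto
  moreover have "{1..4::int} = {1, 2, 3, 4}" by auto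
  ultimately show ?thesis
    using pq b by (intro exI[of _ p]) (auto simp: dilation_def)
qed

text \<open>
  With at least two elements, \<open>(m + 1) * d = d + m * d\<close> is a sum of two distinct ones, so it
  bounds \<open>b\<close>; and \<open>b\<close>, as a subset sum, is a multiple of \<open>d\<close> beyond \<open>m * d\<close>.
\<close>

lemma minimal_insert_max_dilation:
  assumes "0 < d" "B = dilation d {1..int m}" "2 \<le> m"
    and "\<forall>x\<in>B. x < b" and min: "minimal_subset_sums (insert b B)"
  shows "insert b B = dilation d {1..int m + 1}"
proof -
  have fin: "finite B" and "\<forall>x\<in>B. 0 < x" using assms(1,2) by (auto simp: dilation_def)
  have dm: "d * int m \<in> B" and d: "d \<in> B"
    using assms(2,3) by (auto simp: dilation_def intro: image_eqI[of _ _ 1])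
  then have pos: "\<forall>x\<in>insert b B. 0 < x" using \<open>\<forall>x\<in>B. 0 < x\<close> assms(4) by fastforce
  have card: "card B = m"
    using assms(1,2) by (simp add: dilation_def card_image inj_on_def)
  note least_sum = minimal_insert_max[OF fin pos assms(4) min, unfolded card, OF assms(3)]
  have "d * (int m + 1) \<in> subset_sums B"
    using add_in_subset_sums[OF d dm] assms(1,3) by (simp add: algebra_simps)
  moreover have "d * (int m + 1) \<notin> insert 0 B"
    using assms(1,2) by (auto simp: dilation_def)
  ultimately have "b \<le> d * (int m + 1)" by (rule least_sum(3))
  moreover have "d dvd b"
  proof -
    obtain X where "X \<subseteq> B" "b = \<Sum>X" using least_sum(1) by (auto simp: subset_sums_def)
    then show ?thesis using assms(2) by (auto simp: dilation_def intro!: dvd_sum)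
  qed
  then obtain q where "b = d * q" by blast
  moreover have "d * int m < b" using assms(4) dm by blast
  ultimately have "b = d * (int m + 1)"
    using assms(1) by (simp add: mult_less_cancel_left mult_le_cancel_left)
  moreover have "{1..int m + 1} = insert (int m + 1) {1..int m}" by auto
  ultimately show ?thesis by (simp add: assms(2) dilation_def)
qed

lemma minimal_imp_dilation:
  assumes "finite B" "\<forall>x\<in>B. 0 < x" "minimal_subset_sums B" "4 \<le> card B"
  shows "\<exists>d>0. B = dilation d {1..int (card B)}"
  using assms
proof (induction rule: finite_linorder_max_induct)
  case empty
  then show ?case by simp
next
  case (insert b B)
  note cond = minimal_insert_max_conditions[OF insert.hyps(1) insert.prems(1)
      insert.hyps(2) insert.prems(2)]
  show ?case
  proof (cases "card B = 3")
    case True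
    then show ?thesis
      using minimal_insert_max_three[OF insert.hyps(1) insert.prems(1) insert.hyps(2)
          insert.prems(2)] cond(2) by simp
  next
    case False
    then have "4 \<le> card B" using insert.prems(3) cond(2) by linarith
    then obtain d where "0 < d" "B = dilation d {1..int (card B)}"
      using insert.IH insert.prems(1) cond(1) by auto
    then have "insert b B = dilation d {1..int (card B) + 1}"
      using \<open>4 \<le> card B\<close> insert.hyps(2) insert.prems(2)
      by (intro minimal_insert_max_dilation) auto
    then show ?thesis using \<open>0 < d\<close> cond(2) by (auto simp: algebra_simps)
  qed
qed

lemma insert_zero_dilation:
  assumes "0 \<le> n"
  shows "insert 0 (dilation d {1..n}) = dilation d {0..n}"
proof -
  have "{0..n} = insert 0 {1..n}" using assms by auto
  then show ?thesis by (simp add: dilation_def)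
qed

theorem theorem3p3:
  fixes k :: nat and A :: "int set"
  assumes "k \<ge> 3"
    and "finite A"
    and "card A = k"
    and "\<And>a. a \<in> A \<Longrightarrow> a \<ge> 0"
    and "0 \<in> A"
    and "card (restricted_signed_sumset k A) = (k choose 2) + 1"
  shows "(k = 3 \<longrightarrow> (\<exists>a1 a2. 0 < a1 \<and> a1 < a2 \<and> A = {0, a1, a2})) \<and>
         (k = 4 \<longrightarrow> (\<exists>a1 a2. 0 < a1 \<and> a1 < a2 \<and> A = {0, a1, a2, a1 + a2})) \<and>
         (k \<ge> 5 \<longrightarrow> (\<exists>d. 0 < d \<and> A = dilation d {0..int k - 1}))"
proof -
  define B where "B = A - {0}"
  have A: "A = insert 0 B" using assms(5) by (auto simp: B_def)
  have fin: "finite B" using assms(2) by (simp add: B_def)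
  have pos: "\<forall>x\<in>B. 0 < x" using assms(4) by (force simp: B_def)
  have card: "k = Suc (card B)" using assms(3) fin A pos by auto
  have min: "minimal_subset_sums B"
    using assms(6) card_full_restricted_signed_sumset[OF assms(2)]
    by (simp add: minimal_subset_sums_def B_def[symmetric] card[symmetric] assms(3))
  show ?thesis
  proof (intro conjI impI)
    assume "k = 3"
    then have "card B = 2" using card by simp
    then obtain a b where "B = {a, b}" "a < b"
      by (metis card_2_iff insert_commute linorder_neqE_linordered_idom)
    then show "\<exists>a1 a2. 0 < a1 \<and> a1 < a2 \<and> A = {0, a1, a2}" using A pos by auto
  next
    assume "k = 4"
    then have "card B = 3" using card by simp
    then show "\<exists>a1 a2. 0 < a1 \<and> a1 < a2 \<and> A = {0, a1, a2, a1 + a2}"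
      using minimal_three[OF fin pos min] A by blast
  next
    assume "k \<ge> 5"
    then have "4 \<le> card B" using card by simp
    then obtain d where d: "0 < d" "B = dilation d {1..int (card B)}"
      using minimal_imp_dilation[OF fin pos min] by blast
    have "A = dilation d {0..int (card B)}"
      using A d(2) insert_zero_dilation[of "int (card B)" d] by simp
    then show "\<exists>d. 0 < d \<and> A = dilation d {0..int k - 1}" using d(1) card by auto
  qed
qed

end
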